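(* Consider the one-dimensional DG scheme with Euler forward time discretization described in the context. Suppose $r^n>0$ (hence $c^n>0$), and suppose the parameters $\alpha$ and $\tilde\alpha$ satisfy $$\alpha>\max_{1\le j\le N-1}\left\{u^+_{j+\frac12},0\right\},\qquad \tilde\alpha>\frac12 D_M,\qquad D_M=\max_{1\le j\le N-1}\left\{D^{+}_{j+\frac12},D^-_{j+\frac12}\right\}.$$ Assume moreover that $$\Delta t\le\frac{1}{6z_1p_M},\qquad \Delta t\le\min_{1\le j\le N}\frac{\min\{\Phi_{j-\frac12},\Phi_{j+\frac12}\}}{6\max\{-q(x_j^1),-q(x_j^2),0\}},$$ and $$\lambda\le\min_{1\le j\le N-1}\left\{\frac{\Phi_m}{6\alpha},\frac{\Phi_{j+\frac12}}{6(\alpha-u^+_{j+\frac12})}\right\},\qquad \Phi_m=\min_{1\le j\le N-1}\Phi_{j+\frac12},$$ $$\Lambda\le\min_{1\le j\le N}\min\left\{\frac{\Phi_{j-\frac12}}{6\tilde\alpha+3D^-_{j+\frac12}},\frac{\Phi_{j+\frac12}}{6\tilde\alpha+3D^+_{j-\frac12}}\right\}.$$ Then $\bar r_j^{n+1}>0$ for all $j=1,\dots,N$.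
   Context: Mesh and spaces. $\Omega=[0,2\pi]$ is partitioned uniformly into cells $I_j=(x_{j-\frac12},x_{j+\frac12})$, $j=1,\dots,N$ ($N\ge2$), of length $\Delta x$, with $x_{\frac12}=0$, $x_{N+\frac12}=2\pi$. $V_h$ is the space of functions that are polynomials of degree $\le1$ on each $I_j$. For a piecewise smooth $v$, $v^-_{j+\frac12}$ and $v^+_{j+\frac12}$ are its left and right limits at $x_{j+\frac12}$, with $v^-_{\frac12}=0$ and $v^+_{N+\frac12}=0$ in jumps; $[v]=v^+-v^-$, $\{v\}=\frac12(v^++v^-)$. $\bar v_j$ is the average of $v$ over $I_j$. $(v,w)=\int_\Omega vw\,dx$. Data. $\phi>0$ is the porosity; $\Phi$ is its continuous piecewise linear interpolant with $\Phi_{j+\frac12}=\phi(x_{j+\frac12})$. $z_1,z_2>0$ are compressibility factors. $a(c)=\mu(c)/\kappa$ ($\mu$ viscosity, $\kappa$ permeability), $q$ is the external flow rate, $\tilde c\in[0,1]$ is the concentration in the external flow, with $\tilde c$ equal to the numerical $c$ at points where $q<0$. $D(u)\ge0$ is the diffusion coefficient and $D^\pm_{j+\frac12}=D(u^\pm_{j+\frac12})$. $\alpha,\tilde\alpha$ are positive constants. For $r\in V_h$, $c\in V_h$ is the piecewise linear function with $c^+_{j-\frac12}=r^+_{j-\frac12}/\Phi_{j-\frac12}$ and $c^-_{j+\frac12}=r^-_{j+\frac12}/\Phi_{j+\frac12}$ in each $I_j$; $\tilde d(r)=z_1r+z_2(\Phi-r)$. Scheme. $p,u,r\in V_h$ are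 such that for all $\xi,\eta,\zeta\in V_h$ $$(\tilde d(r)p_t,\xi)=(u,\xi_x)+\sum_{j=1}^{N-1}\hat u[\xi]_{j+\frac12}+(q,\xi),$$ $$(a(c)u,\eta)=(p,\eta_x)+\sum_{j=0}^{N}\hat p[\eta]_{j+\frac12},$$ $$(r_t,\zeta)=(uc-D(u)c_x,\zeta_x)+\sum_{j=1}^{N-1}\widehat{uc}[\zeta]_{j+\frac12}-\sum_{j=1}^{N-1}\{D(u)c_x\}[\zeta]_{j+\frac12}-\sum_{j=1}^{N-1}\{D(u)\zeta_x\}[c]_{j+\frac12}-\sum_{j=1}^{N-1}\frac{\tilde\alpha}{\Delta x}[c][\zeta]_{j+\frac12}+(\tilde cq-rz_1p_t,\zeta),$$ with fluxes $\hat u=u^+$, $\hat p=p^-$, $\widehat{uc}=u^+c^+-\alpha[c]$ at interior interfaces, and $\hat p_{\frac12}=p^+_{\frac12}$, $\hat p_{N+\frac12}=p^-_{N+\frac12}$. Euler forward: all quantities are at time level $n$ (superscript omitted), $p_t\in V_h$ satisfies the first equation, and $r^{n+1}\in V_h$ is given by the third equation with $r_t=(r^{n+1}-r^n)/\Delta t$, $\Delta t>0$. The source integrals ($q$, $\tilde cq$, $rz_1p_t$, $\tilde d(r)p_t$) over $I_j$ are evaluated by 2-point Gaussian quadrature with points $x_j^1,x_j^2$. Notation. $\lambda=\Delta t/\Delta x$, $\Lambda=\Delta t/\Delta x^2$, $p_M=\max_{i,j}\max\{p_t(x_j^i),0\}$ (max over $i=1,2$, $1\le j\le N$). $r^n>0$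 means positivity on every cell including the one-sided limits at the endpoints. A fraction with zero denominator is interpreted as $+\infty$. *)

theory Defs
  imports "HOL-Analysis.Analysis" "HOL-Computational_Algebra.Polynomial"
begin

definition mesh_size :: "nat \<Rightarrow> real"
  where "mesh_size N = 2 * pi / real N"

text \<open>Interfaces carry the integer index \<open>j\<close> in place of the half-integer \<open>j + 1/2\<close>:
  \<open>node N j\<close> is \<open>x\<^bsub>j+1/2\<^esub>\<close>, so that the cell with index \<open>j\<close> (for \<open>1 \<le> j \<le> N\<close>)
  lies between the nodes \<open>j - 1\<close> and \<open>j\<close>.\<close>

definition node :: "nat \<Rightarrow> nat \<Rightarrow> real"
  where "node N j = real j * mesh_size N"

definition cell :: "nat \<Rightarrow> nat \<Rightarrow> real set"
  where "cell N j = {node N (j - 1)<..<node N j}"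

text \<open>The values of an element of \<open>V_h\<close> at the nodes (and outside the domain) are
  irrelevant: only integrals, one-sided limits and values inside the open cells are used.\<close>

definition V_h :: "nat \<Rightarrow> (real \<Rightarrow> real) set"
  where "V_h N = {v. \<forall>j\<in>{1..N}. \<exists>P :: real poly. degree P \<le> 1 \<and> (\<forall>x\<in>cell N j. v x = poly P x)}"

definition trace_minus :: "nat \<Rightarrow> (real \<Rightarrow> real) \<Rightarrow> nat \<Rightarrow> real"
  where "trace_minus N v j = Lim (at_left (node N j)) v"

definition trace_plus :: "nat \<Rightarrow> (real \<Rightarrow> real) \<Rightarrow> nat \<Rightarrow> real"
  where "trace_plus N v j = Lim (at_right (node N j)) v"

text \<open>In jumps, the traces from outside the domain are zero.\<close>

definition jump :: "nat \<Rightarrow> (real \<Rightarrow> real) \<Rightarrow> nat \<Rightarrow> real"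
  where "jump N v j =
    (if j = N then 0 else trace_plus N v j) - (if j = 0 then 0 else trace_minus N v j)"

definition cell_average :: "nat \<Rightarrow> (real \<Rightarrow> real) \<Rightarrow> nat \<Rightarrow> real"
  where "cell_average N v j = integral (cell N j) v / mesh_size N"

definition inner_L2 :: "(real \<Rightarrow> real) \<Rightarrow> (real \<Rightarrow> real) \<Rightarrow> real"
  where "inner_L2 v w = integral {0..2 * pi} (\<lambda>x. v x * w x)"

definition gauss_point :: "nat \<Rightarrow> nat \<Rightarrow> nat \<Rightarrow> real"
  where "gauss_point N i j =
    (node N (j - 1) + node N j) / 2 + (if i = 1 then - 1 else 1) * mesh_size N / (2 * sqrt 3)"

definition inner_gauss :: "nat \<Rightarrow> (real \<Rightarrow> real) \<Rightarrow> (real \<Rightarrow> real) \<Rightarrow> real"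
  where "inner_gauss N v w =
    (\<Sum>j = 1..N. mesh_size N / 2 * (\<Sum>i = 1..2. v (gauss_point N i j) * w (gauss_point N i j)))"

definition positive_on_cells :: "nat \<Rightarrow> (real \<Rightarrow> real) \<Rightarrow> bool"
  where "positive_on_cells N v \<longleftrightarrow>
    (\<forall>j\<in>{1..N}. (\<forall>x\<in>cell N j. v x > 0) \<and> trace_plus N v (j - 1) > 0 \<and> trace_minus N v j > 0)"

definition pl_interpolant :: "nat \<Rightarrow> (real \<Rightarrow> real) \<Rightarrow> (real \<Rightarrow> real) \<Rightarrow> bool"
  where "pl_interpolant N \<phi> \<Phi> \<longleftrightarrow>
    \<Phi> \<in> V_h N \<and> continuous_on {0..2 * pi} \<Phi> \<and> (\<forall>j\<in>{0..N}. \<Phi> (node N j) = \<phi> (node N j))"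

definition concentration_of ::
    "nat \<Rightarrow> (real \<Rightarrow> real) \<Rightarrow> (real \<Rightarrow> real) \<Rightarrow> (real \<Rightarrow> real) \<Rightarrow> bool"
  where "concentration_of N \<Phi> r c \<longleftrightarrow>
    c \<in> V_h N \<and>
    (\<forall>j\<in>{1..N}. trace_plus N c (j - 1) = trace_plus N r (j - 1) / \<Phi> (node N (j - 1)) \<and>
                 trace_minus N c j = trace_minus N r j / \<Phi> (node N j))"

text \<open>The external concentration: a prescribed value in \<open>[0, 1]\<close> at points where \<open>q \<ge> 0\<close>,
  and the numerical concentration where \<open>q < 0\<close> (no upper bound on \<open>c\<close> is imposed there).\<close>

definition external_concentration ::
    "nat \<Rightarrow> (real \<Rightarrow> real) \<Rightarrow> (real \<Rightarrow> real) \<Rightarrow> (real \<Rightarrow> real) \<Rightarrow> bool"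
  where "external_concentration N q c ct \<longleftrightarrow>
    (\<forall>j\<in>{1..N}. \<forall>x\<in>cell N j. if q x < 0 then ct x = c x else 0 \<le> ct x \<and> ct x \<le> 1)"

definition d_tilde :: "real \<Rightarrow> real \<Rightarrow> (real \<Rightarrow> real) \<Rightarrow> (real \<Rightarrow> real) \<Rightarrow> real \<Rightarrow> real"
  where "d_tilde z1 z2 \<Phi> r x = z1 * r x + z2 * (\<Phi> x - r x)"

text \<open>In the three equations the derivatives of elements of \<open>V_h\<close> are the broken ones,
  since \<open>deriv\<close> is only relevant inside the open cells.\<close>

definition pressure_equation ::
    "nat \<Rightarrow> real \<Rightarrow> real \<Rightarrow> (real \<Rightarrow> real) \<Rightarrow> (real \<Rightarrow> real) \<Rightarrow>
     (real \<Rightarrow> real) \<Rightarrow> (real \<Rightarrow> real) \<Rightarrow> (real \<Rightarrow> real) \<Rightarrow> bool"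
  where "pressure_equation N z1 z2 \<Phi> q pt u r \<longleftrightarrow>
    (\<forall>\<xi>\<in>V_h N.
      inner_gauss N (\<lambda>x. d_tilde z1 z2 \<Phi> r x * pt x) \<xi> =
        inner_L2 u (deriv \<xi>) + (\<Sum>j = 1..N - 1. trace_plus N u j * jump N \<xi> j)
        + inner_gauss N q \<xi>)"

definition flux_p :: "nat \<Rightarrow> (real \<Rightarrow> real) \<Rightarrow> nat \<Rightarrow> real"
  where "flux_p N p j = (if j = 0 then trace_plus N p j else trace_minus N p j)"

definition velocity_equation ::
    "nat \<Rightarrow> (real \<Rightarrow> real) \<Rightarrow> (real \<Rightarrow> real) \<Rightarrow>
     (real \<Rightarrow> real) \<Rightarrow> (real \<Rightarrow> real) \<Rightarrow> (real \<Rightarrow> real) \<Rightarrow> bool"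
  where "velocity_equation N \<mu> \<kappa> p u c \<longleftrightarrow>
    (\<forall>\<eta>\<in>V_h N.
      inner_L2 (\<lambda>x. \<mu> (c x) / \<kappa> x * u x) \<eta> =
        inner_L2 p (deriv \<eta>) + (\<Sum>j = 0..N. flux_p N p j * jump N \<eta> j))"

definition flux_uc :: "nat \<Rightarrow> real \<Rightarrow> (real \<Rightarrow> real) \<Rightarrow> (real \<Rightarrow> real) \<Rightarrow> nat \<Rightarrow> real"
  where "flux_uc N \<alpha> u c j = trace_plus N u j * trace_plus N c j - \<alpha> * jump N c j"

text \<open>The average \<open>{D(u) v_x}\<close> at an interface. The one-sided values of \<open>D(u)\<close> are by
  convention \<open>D(u\<^sup>\<plusminus>)\<close>, so that no continuity of \<open>D\<close> is needed.\<close>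

definition average_diffusion ::
    "nat \<Rightarrow> (real \<Rightarrow> real) \<Rightarrow> (real \<Rightarrow> real) \<Rightarrow> (real \<Rightarrow> real) \<Rightarrow> nat \<Rightarrow> real"
  where "average_diffusion N D u v j =
    (D (trace_plus N u j) * trace_plus N (deriv v) j
      + D (trace_minus N u j) * trace_minus N (deriv v) j) / 2"

definition transport_equation ::
    "nat \<Rightarrow> real \<Rightarrow> real \<Rightarrow> real \<Rightarrow> (real \<Rightarrow> real) \<Rightarrow> (real \<Rightarrow> real) \<Rightarrow> (real \<Rightarrow> real) \<Rightarrow>
     (real \<Rightarrow> real) \<Rightarrow> (real \<Rightarrow> real) \<Rightarrow> (real \<Rightarrow> real) \<Rightarrow> (real \<Rightarrow> real) \<Rightarrow>
     (real \<Rightarrow> real) \<Rightarrow> bool"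
  where "transport_equation N z1 \<alpha> \<alpha>t D q ct pt u r c rt \<longleftrightarrow>
    (\<forall>\<zeta>\<in>V_h N.
      inner_L2 rt \<zeta> =
        inner_L2 (\<lambda>x. u x * c x - D (u x) * deriv c x) (deriv \<zeta>)
        + (\<Sum>j = 1..N - 1. flux_uc N \<alpha> u c j * jump N \<zeta> j)
        - (\<Sum>j = 1..N - 1. average_diffusion N D u c j * jump N \<zeta> j)
        - (\<Sum>j = 1..N - 1. average_diffusion N D u \<zeta> j * jump N c j)
        - (\<Sum>j = 1..N - 1. \<alpha>t / mesh_size N * jump N c j * jump N \<zeta> j)
        + inner_gauss N (\<lambda>x. ct x * q x - r x * z1 * pt x) \<zeta>)"

definition bound_frac :: "real \<Rightarrow> real \<Rightarrow> ereal"
  where "bound_frac a b = (if b = 0 then \<infinity> else ereal (a / b))"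

definition D_M :: "nat \<Rightarrow> (real \<Rightarrow> real) \<Rightarrow> (real \<Rightarrow> real) \<Rightarrow> real"
  where "D_M N D u =
    Max ((\<lambda>j. max (D (trace_plus N u j)) (D (trace_minus N u j))) ` {1..N - 1})"

definition p_M :: "nat \<Rightarrow> (real \<Rightarrow> real) \<Rightarrow> real"
  where "p_M N pt = Max ((\<lambda>(i, j). max (pt (gauss_point N i j)) 0) ` ({1..2} \<times> {1..N}))"

definition Phi_m :: "nat \<Rightarrow> (real \<Rightarrow> real) \<Rightarrow> real"
  where "Phi_m N \<Phi> = Min ((\<lambda>j. \<Phi> (node N j)) ` {1..N - 1})"

end

theory Submission
  imports Defs
begin

text \<open>Testing the transport equation with the indicator function of a cell turns it into a balance
  law for the average of \<open>r\<close> over that cell: the new average is the old one, plus \<open>\<Delta>t / \<Delta>x\<close> times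
  inflow minus outflow through the two ends of the cell, plus the source at the two Gauss points
  (lemma \<open>cell_average_update\<close>). Since \<open>r\<close> is affine on the cell, the old average is the mean of its
  two end values, \<open>B / 2\<close> with \<open>B = \<Phi>\<^sub>l c\<^sub>l + \<Phi>\<^sub>r c\<^sub>r\<close>, where \<open>c\<^sub>l, c\<^sub>r\<close> are the values of \<open>c\<close> at the ends of
  the cell and \<open>\<Phi>\<^sub>l, \<Phi>\<^sub>r\<close> those of the porosity. This supply is spent in three equal parts \<open>B / 6\<close>.

  The source takes at most one part (\<open>source_lower_bound\<close>). The 2-point Gauss sum of an affine function
  equals the sum of its end values. The pressure term removes at most \<open>\<Delta>t z\<^sub>1 p\<^sub>M\<close> times the average of
  \<open>r\<close>. Production (\<open>q < 0\<close>) extracts fluid at concentration \<open>c\<close> and hence removes at most a multiple of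
  the average of \<open>c\<close>, which is at most the average of \<open>r\<close> divided by the smaller end value of the
  porosity.

  Convection and diffusion take at most one part each. Written in terms of the one-sided values of \<open>c\<close>,
  the total flux through an interface is a linear combination in which, by \<open>\<alpha> > u\<^sup>+\<close> and
  \<open>2 \<alpha>\<^sub>t \<ge> D\<close>, every value of the neighbouring cell acts in favour of the cell under consideration
  and can be dropped (\<open>interface_flux_less\<close>, \<open>interface_flux_greater\<close>). What remains are multiples of
  \<open>c\<^sub>l\<close> and \<open>c\<^sub>r\<close>, and the bounds on \<open>\<Delta>t / \<Delta>x\<close> and \<open>\<Delta>t / \<Delta>x\<^sup>2\<close> say that their coefficients are at
  most \<open>\<Phi>\<^sub>l / 6\<close> and \<open>\<Phi>\<^sub>r / 6\<close>. The three parts could use up the supply exactly, but a dropped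
  neighbouring value is strictly positive, and because \<open>N \<ge> 2\<close> every cell has a neighbour.\<close>

section \<open>The mesh\<close>

text \<open>Cell \<open>j\<close> starts at node \<open>j - 1\<close>; keeping \<open>1\<close> out of successor notation lets the simplifier
  recognise these indices.\<close>

declare One_nat_def [simp del]

lemma mesh_size_pos: "N \<ge> 1 \<Longrightarrow> mesh_size N > 0"
  by (simp add: mesh_size_def)

lemma node_pred: "j \<ge> 1 \<Longrightarrow> node N j = node N (j - 1) + mesh_size N"
  by (simp add: node_def of_nat_diff algebra_simps)

lemma node_less_iff: "N \<ge> 1 \<Longrightarrow> node N i < node N j \<longleftrightarrow> i < j"
  using mesh_size_pos[of N] by (simp add: node_def)

lemma node_le_iff: "N \<ge> 1 \<Longrightarrow> node N i \<le> node N j \<longleftrightarrow> i \<le> j"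
  using mesh_size_pos[of N] by (simp add: node_def)

lemma node_0: "node N 0 = 0"
  by (simp add: node_def)

lemma node_last: "N \<ge> 1 \<Longrightarrow> node N N = 2 * pi"
  by (simp add: node_def mesh_size_def)

lemma node_in_domain: "N \<ge> 1 \<Longrightarrow> j \<le> N \<Longrightarrow> node N j \<in> {0..2 * pi}"
  using node_le_iff[of N 0 j] node_le_iff[of N j N] by (simp add: node_0 node_last)

lemma cell_subset_domain:
  assumes "j \<in> {1..N}"
  shows "cell N j \<subseteq> {0..2 * pi}"
proof -
  have "1 \<le> N" "j - 1 \<le> N" "j \<le> N"
    using assms by auto
  then show ?thesis
    using node_in_domain[of N "j - 1"] node_in_domain[of N j] by (auto simp: cell_def)
qed

lemma cell_disjoint:
  assumes "x \<in> cell N j" "x \<in> cell N k" "N \<ge> 1" "j \<ge> 1" "k \<ge> 1"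
  shows "j = k"
proof -
  have "node N (j - 1) < node N k" "node N (k - 1) < node N j"
    using assms(1,2) by (auto simp: cell_def)
  then show ?thesis
    using assms(3-5) by (simp add: node_less_iff)
qed

lemma in_some_cell:
  assumes "N \<ge> 1" "x \<in> {0..2 * pi}" "x \<notin> node N ` {0..N}"
  shows "\<exists>j\<in>{1..N}. x \<in> cell N j"
proof -
  let ?k = "LEAST k. x \<le> node N k"
  have ex: "x \<le> node N N"
    using assms by (simp add: node_last)
  have le: "x \<le> node N ?k"
    using ex by (rule LeastI)
  have kN: "?k \<le> N"
    using ex by (rule Least_le)
  have "?k \<noteq> 0"
  proof
    assume "?k = 0"
    then have "x = node N 0"
      using le assms(2) by (simp add: node_0)
    then show False
      using assms(3) by auto
  qed
  moreover have "\<not> x \<le> node N (?k - 1)"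
    using calculation by (intro not_less_Least) auto
  moreover have "x \<noteq> node N ?k"
    using assms(3) kN by auto
  ultimately show ?thesis
    using le kN by (intro bexI[of _ ?k]) (auto simp: cell_def)
qed

section \<open>Functions that are affine on each cell\<close>

lemma trace_plus_eqI:
  assumes "N \<ge> 1" "j \<ge> 1" "\<And>x. x \<in> cell N j \<Longrightarrow> v x = f x" "isCont f (node N (j - 1))"
  shows "trace_plus N v (j - 1) = f (node N (j - 1))"
proof -
  have "eventually (\<lambda>x. x \<in> cell N j) (at_right (node N (j - 1)))"
    using node_less_iff[of N "j - 1" j] assms(1,2)
    by (auto simp: cell_def intro: eventually_at_rightI)
  then have "eventually (\<lambda>x. f x = v x) (at_right (node N (j - 1)))"
    by eventually_elim (simp add: assms(3))
  moreover have "(f \<longlongrightarrow> f (node N (j - 1))) (at_right (node N (j - 1)))"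
    using assms(4) by (simp add: isCont_def filterlim_at_split)
  ultimately have "(v \<longlongrightarrow> f (node N (j - 1))) (at_right (node N (j - 1)))"
    by (rule Lim_transform_eventually[rotated])
  then show ?thesis
    unfolding trace_plus_def by (intro tendsto_Lim) auto
qed

lemma trace_minus_eqI:
  assumes "N \<ge> 1" "j \<ge> 1" "\<And>x. x \<in> cell N j \<Longrightarrow> v x = f x" "isCont f (node N j)"
  shows "trace_minus N v j = f (node N j)"
proof -
  have "eventually (\<lambda>x. x \<in> cell N j) (at_left (node N j))"
    using node_less_iff[of N "j - 1" j] assms(1,2)
    by (auto simp: cell_def intro: eventually_at_leftI)
  then have "eventually (\<lambda>x. f x = v x) (at_left (node N j))"
    by eventually_elim (simp add: assms(3))
  moreover have "(f \<longlongrightarrow> f (node N j)) (at_left (node N j))"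
    using assms(4) by (simp add: isCont_def filterlim_at_split)
  ultimately have "(v \<longlongrightarrow> f (node N j)) (at_left (node N j))"
    by (rule Lim_transform_eventually[rotated])
  then show ?thesis
    unfolding trace_minus_def by (intro tendsto_Lim) auto
qed

definition cell_slope :: "nat \<Rightarrow> (real \<Rightarrow> real) \<Rightarrow> nat \<Rightarrow> real"
  where "cell_slope N v j = (trace_minus N v j - trace_plus N v (j - 1)) / mesh_size N"

text \<open>An affine function on a cell is the interpolant of its one-sided limits at the two ends. This
  replaces the polynomial in the definition of \<open>V_h\<close> by the traces that appear in the scheme.\<close>

lemma V_h_affine:
  assumes "v \<in> V_h N" "j \<in> {1..N}" "x \<in> cell N j"
  shows "v x = trace_plus N v (j - 1) + cell_slope N v j * (x - node N (j - 1))"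
proof -
  obtain P :: "real poly" where P: "degree P \<le> 1" "\<And>x. x \<in> cell N j \<Longrightarrow> v x = poly P x"
    using assms(1,2) unfolding V_h_def by blast
  have "P = [:coeff P 0, coeff P 1:]"
    using P(1) by (intro poly_eqI) (auto simp: coeff_pCons One_nat_def coeff_eq_0 split: nat.split)
  then obtain a b where affine: "P = [:a, b:]"
    by blast
  have "trace_plus N v (j - 1) = poly P (node N (j - 1))"
    using assms P by (intro trace_plus_eqI) auto
  moreover have "trace_minus N v j = poly P (node N j)"
    using assms P by (intro trace_minus_eqI) auto
  moreover have "mesh_size N > 0" "node N j = node N (j - 1) + mesh_size N"
    using assms(2) mesh_size_pos[of N] node_pred[of j N] by auto
  ultimately show ?thesis
    using P(2)[OF assms(3)] by (simp add: affine cell_slope_def field_simps)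
qed

lemma deriv_V_h:
  assumes "v \<in> V_h N" "j \<in> {1..N}" "x \<in> cell N j"
  shows "deriv v x = cell_slope N v j"
proof (rule DERIV_imp_deriv)
  have "((\<lambda>y. trace_plus N v (j - 1) + cell_slope N v j * (y - node N (j - 1)))
      has_field_derivative cell_slope N v j) (at x)"
    by (auto intro!: derivative_eq_intros)
  moreover have "open (cell N j)"
    by (simp add: cell_def)
  ultimately show "(v has_field_derivative cell_slope N v j) (at x)"
    using assms(3) by (rule has_field_derivative_transform_within_open)
      (simp add: V_h_affine[OF assms(1,2)])
qed

lemma trace_plus_deriv:
  "v \<in> V_h N \<Longrightarrow> j \<in> {1..N} \<Longrightarrow> trace_plus N (deriv v) (j - 1) = cell_slope N v j"
  by (rule trace_plus_eqI) (auto intro: deriv_V_h)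

lemma trace_minus_deriv:
  "v \<in> V_h N \<Longrightarrow> j \<in> {1..N} \<Longrightarrow> trace_minus N (deriv v) j = cell_slope N v j"
  by (rule trace_minus_eqI) (auto intro: deriv_V_h)

lemma V_h_has_integral:
  assumes "v \<in> V_h N" "j \<in> {1..N}"
  shows "(v has_integral mesh_size N * (trace_plus N v (j - 1) + trace_minus N v j) / 2) (cell N j)"
proof -
  let ?a = "node N (j - 1)" and ?b = "node N j" and ?h = "mesh_size N"
  let ?f = "\<lambda>x. trace_plus N v (j - 1) + cell_slope N v j * (x - ?a)"
  let ?F = "\<lambda>x. trace_plus N v (j - 1) * x + cell_slope N v j * (x - ?a)^2 / 2"
  have h: "?h > 0" and b: "?b = ?a + ?h"
    using assms(2) mesh_size_pos[of N] node_pred[of j N] by auto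
  have "(?f has_integral (?F ?b - ?F ?a)) {?a..?b}"
    using h b by (intro fundamental_theorem_of_calculus)
      (auto intro!: derivative_eq_intros simp flip: has_real_derivative_iff_has_vector_derivative)
  moreover have "?F ?b - ?F ?a = ?h * (trace_plus N v (j - 1) + trace_minus N v j) / 2"
    using h by (simp add: b cell_slope_def field_simps power2_eq_square)
  ultimately have "(?f has_integral ?h * (trace_plus N v (j - 1) + trace_minus N v j) / 2) (cell N j)"
    by (simp only: cell_def has_integral_Icc_iff_Ioo)
  then show ?thesis
    by (rule has_integral_eq[rotated]) (simp add: V_h_affine[OF assms])
qed

lemma cell_average_V_h:
  assumes "v \<in> V_h N" "j \<in> {1..N}"
  shows "cell_average N v j = (trace_plus N v (j - 1) + trace_minus N v j) / 2"
  using V_h_has_integral[OF assms, THEN integral_unique] mesh_size_pos[of N] assms(2)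
  by (simp add: cell_average_def)

lemma gauss_point_in_cell:
  assumes "j \<in> {1..N}"
  shows "gauss_point N i j \<in> cell N j"
proof -
  have h: "mesh_size N > 0" "node N j = node N (j - 1) + mesh_size N"
    using assms mesh_size_pos[of N] node_pred[of j N] by auto
  \<comment> \<open>The distance of the Gauss points from the midpoint.\<close>
  define d where "d = mesh_size N / (2 * sqrt 3)"
  have "1 < sqrt (3::real)"
    by simp
  then have "d < mesh_size N / 2" "0 < d"
    using h(1) by (auto simp: d_def divide_simps)
  moreover have "gauss_point N i j = node N (j - 1) + mesh_size N / 2 + (if i = 1 then - d else d)"
    by (simp add: gauss_point_def d_def h(2) field_simps)
  ultimately show ?thesis
    by (auto simp: cell_def h(2))
qed

text \<open>The two Gauss points lie symmetrically about the midpoint of the cell, so the linear part of an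
  affine function cancels up to its value at the midpoint.\<close>

lemma V_h_gauss_sum:
  assumes "v \<in> V_h N" "j \<in> {1..N}"
  shows "v (gauss_point N 1 j) + v (gauss_point N 2 j)
    = trace_plus N v (j - 1) + trace_minus N v j"
proof -
  have h: "mesh_size N > 0" "node N j = node N (j - 1) + mesh_size N"
    using assms mesh_size_pos[of N] node_pred[of j N] by auto
  have "v (gauss_point N 1 j) + v (gauss_point N 2 j) = 2 * trace_plus N v (j - 1)
      + cell_slope N v j * (gauss_point N 1 j + gauss_point N 2 j - 2 * node N (j - 1))"
    by (simp add: V_h_affine[OF assms gauss_point_in_cell[OF assms(2)]] algebra_simps)
  also have "gauss_point N 1 j + gauss_point N 2 j - 2 * node N (j - 1) = mesh_size N"
    using h by (simp add: gauss_point_def)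
  finally show ?thesis
    using h by (simp add: cell_slope_def)
qed

text \<open>Inside the cell an affine function is a proper convex combination of its end values.\<close>

lemma V_h_pos_in_cell:
  assumes "v \<in> V_h N" "j \<in> {1..N}" "x \<in> cell N j"
    and "trace_plus N v (j - 1) > 0" "trace_minus N v j > 0"
  shows "v x > 0"
proof -
  define t where "t = (x - node N (j - 1)) / mesh_size N"
  have h: "mesh_size N > 0" "node N j = node N (j - 1) + mesh_size N"
    using assms(2) mesh_size_pos[of N] node_pred[of j N] by auto
  have t: "0 < t" "t < 1"
    using assms(3) h by (auto simp: t_def cell_def)
  have "v x = (1 - t) * trace_plus N v (j - 1) + t * trace_minus N v j"
    using h by (simp add: V_h_affine[OF assms(1-3)] cell_slope_def t_def field_simps)
  also have "\<dots> > 0"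
    using t assms(4,5) by (intro add_pos_pos mult_pos_pos) auto
  finally show ?thesis .
qed

section \<open>The indicator of a cell as a test function\<close>

definition cell_indicator :: "nat \<Rightarrow> nat \<Rightarrow> real \<Rightarrow> real"
  where "cell_indicator N j x = of_bool (x \<in> cell N j)"

lemma cell_indicator_on_cell:
  assumes "j \<in> {1..N}" "k \<in> {1..N}" "x \<in> cell N k"
  shows "cell_indicator N j x = of_bool (k = j)"
  using assms cell_disjoint[of x N j k] by (auto simp: cell_indicator_def)

lemma cell_indicator_in_V_h:
  assumes "j \<in> {1..N}"
  shows "cell_indicator N j \<in> V_h N"
  unfolding V_h_def
proof (intro CollectI ballI)
  fix k assume "k \<in> {1..N}"
  then show "\<exists>P :: real poly. degree P \<le> 1 \<and> (\<forall>x\<in>cell N k. cell_indicator N j x = poly P x)"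
    using assms by (intro exI[of _ "[:of_bool (k = j):]"]) (simp add: cell_indicator_on_cell)
qed

lemma trace_plus_cell_indicator:
  assumes "j \<in> {1..N}" "k \<in> {1..N}"
  shows "trace_plus N (cell_indicator N j) (k - 1) = of_bool (k = j)"
  using assms
  by (intro trace_plus_eqI[where f = "\<lambda>_. of_bool (k = j)"]) (auto simp: cell_indicator_on_cell)

lemma trace_minus_cell_indicator:
  assumes "j \<in> {1..N}" "k \<in> {1..N}"
  shows "trace_minus N (cell_indicator N j) k = of_bool (k = j)"
  using assms
  by (intro trace_minus_eqI[where f = "\<lambda>_. of_bool (k = j)"]) (auto simp: cell_indicator_on_cell)

lemma cell_slope_cell_indicator:
  "j \<in> {1..N} \<Longrightarrow> k \<in> {1..N} \<Longrightarrow> cell_slope N (cell_indicator N j) k = 0"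
  by (simp add: cell_slope_def trace_plus_cell_indicator trace_minus_cell_indicator)

lemma jump_cell_indicator:
  assumes "j \<in> {1..N}" "k \<in> {1..N - 1}"
  shows "jump N (cell_indicator N j) k = of_bool (k = j - 1) - of_bool (k = j)"
proof -
  have k: "Suc k \<in> {1..N}" "k \<in> {1..N}" "k \<noteq> 0" "k \<noteq> N"
    using assms by auto
  have "Suc k = j \<longleftrightarrow> k = j - 1"
    using assms by auto
  then show ?thesis
    using trace_plus_cell_indicator[OF assms(1) k(1)] trace_minus_cell_indicator[OF assms(1) k(2)] k
    by (simp add: jump_def)
qed

text \<open>Only the two ends of cell \<open>j\<close> contribute. The interfaces run from \<open>1\<close> to \<open>N - 1\<close>, so an end on
  the boundary of the domain contributes nothing: no flux passes there.\<close>

lemma sum_jump_cell_indicator: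
  assumes "j \<in> {1..N}"
  shows "(\<Sum>k = 1..N - 1. F k * jump N (cell_indicator N j) k)
    = of_bool (2 \<le> j) * F (j - 1) - of_bool (j < N) * F j"
proof -
  have "(\<Sum>k = 1..N - 1. F k * jump N (cell_indicator N j) k)
      = (\<Sum>k = 1..N - 1. (if k = j - 1 then F k else 0) - (if k = j then F k else 0))"
    using assms by (intro sum.cong) (auto simp: jump_cell_indicator)
  also have "\<dots> = (if j - 1 \<in> {1..N - 1} then F (j - 1) else 0)
      - (if j \<in> {1..N - 1} then F j else 0)"
    by (simp only: sum_subtractf sum.delta finite_atLeastAtMost)
  finally have "(\<Sum>k = 1..N - 1. F k * jump N (cell_indicator N j) k) =
      (if j - 1 \<in> {1..N - 1} then F (j - 1) else 0) - (if j \<in> {1..N - 1} then F j else 0)" .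
  moreover have "j - 1 \<in> {1..N - 1} \<longleftrightarrow> 2 \<le> j" "j \<in> {1..N - 1} \<longleftrightarrow> j < N"
    using assms by auto
  ultimately show ?thesis
    by (simp del: atLeastAtMost_iff)
qed

text \<open>The derivative vanishes on every open cell. At the nodes, where the indicator is not
  differentiable, its value is unknown, but these finitely many points do not
  affect the integral.\<close>

lemma inner_L2_deriv_cell_indicator:
  assumes "j \<in> {1..N}"
  shows "inner_L2 v (deriv (cell_indicator N j)) = 0"
proof -
  have "v x * deriv (cell_indicator N j) x = 0"
    if x: "x \<in> {0..2 * pi} - node N ` {0..N}" for x
  proof -
    obtain k where "k \<in> {1..N}" "x \<in> cell N k"
      using in_some_cell[of N x] x assms by auto
    then show ?thesis
      using assms
      by (simp add: deriv_V_h[OF cell_indicator_in_V_h] cell_slope_cell_indicator)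
  qed
  then have "((\<lambda>x. v x * deriv (cell_indicator N j) x) has_integral 0) {0..2 * pi}"
    by (rule has_integral_spike_finite[OF finite_imageI[OF finite_atLeastAtMost] _ has_integral_0])
  then show ?thesis
    unfolding inner_L2_def by (rule integral_unique)
qed

lemma average_diffusion_cell_indicator:
  assumes "j \<in> {1..N}" "k \<in> {1..N - 1}"
  shows "average_diffusion N D u (cell_indicator N j) k = 0"
proof -
  have k: "Suc k \<in> {1..N}" "k \<in> {1..N}"
    using assms by auto
  show ?thesis
    using trace_plus_deriv[OF cell_indicator_in_V_h[OF assms(1)] k(1)]
      trace_minus_deriv[OF cell_indicator_in_V_h[OF assms(1)] k(2)]
    by (simp add: average_diffusion_def cell_slope_cell_indicator[OF assms(1)] k
        del: atLeastAtMost_iff)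
qed

lemma inner_L2_cell_indicator:
  assumes "j \<in> {1..N}"
  shows "inner_L2 v (cell_indicator N j) = integral (cell N j) v"
proof -
  have "inner_L2 v (cell_indicator N j)
      = integral {0..2 * pi} (\<lambda>x. if x \<in> cell N j then v x else 0)"
    unfolding inner_L2_def by (intro integral_cong) (simp add: cell_indicator_def)
  also have "\<dots> = integral (cell N j) v"
    using cell_subset_domain[OF assms] by (simp add: integral_def integrable_on_def)
  finally show ?thesis .
qed

lemma inner_gauss_cell_indicator:
  assumes "j \<in> {1..N}"
  shows "inner_gauss N v (cell_indicator N j)
    = mesh_size N / 2 * (v (gauss_point N 1 j) + v (gauss_point N 2 j))"
proof -
  have "{1..2::nat} = {1, 2}"
    by auto
  then have "inner_gauss N v (cell_indicator N j) = (\<Sum>k = 1..N. if k = j then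
      mesh_size N / 2 * (v (gauss_point N 1 j) + v (gauss_point N 2 j)) else 0)"
    unfolding inner_gauss_def
    using assms by (intro sum.cong)
      (auto simp: cell_indicator_on_cell[OF _ _ gauss_point_in_cell])
  then show ?thesis
    using assms by simp
qed

section \<open>The balance of a cell\<close>

text \<open>The factor multiplying the jump of a test function at an interface in the transport equation: the
  flux of \<open>r\<close> from left to right. The remaining interface term of that equation, the symmetrising one
  with the average of the diffusive derivative of the test function, vanishes for an indicator.\<close>

definition interface_flux ::
    "nat \<Rightarrow> real \<Rightarrow> real \<Rightarrow> (real \<Rightarrow> real) \<Rightarrow> (real \<Rightarrow> real) \<Rightarrow> (real \<Rightarrow> real) \<Rightarrow> nat \<Rightarrow> real"
  where "interface_flux N \<alpha> \<alpha>t D u c j =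
    flux_uc N \<alpha> u c j - average_diffusion N D u c j - \<alpha>t / mesh_size N * jump N c j"

lemma cell_average_update:
  assumes "transport_equation N z1 \<alpha> \<alpha>t D q ct pt u r c (\<lambda>x. (r' x - r x) / \<Delta>t)"
    and "r \<in> V_h N" "r' \<in> V_h N" "\<Delta>t > 0" "j \<in> {1..N}"
  defines "S \<equiv> \<lambda>x. ct x * q x - r x * z1 * pt x"
  shows "cell_average N r' j = cell_average N r j
    + \<Delta>t / mesh_size N * (of_bool (2 \<le> j) * interface_flux N \<alpha> \<alpha>t D u c (j - 1)
        - of_bool (j < N) * interface_flux N \<alpha> \<alpha>t D u c j)
    + \<Delta>t / 2 * (S (gauss_point N 1 j) + S (gauss_point N 2 j))"
proof -
  let ?\<zeta> = "cell_indicator N j" and ?G = "interface_flux N \<alpha> \<alpha>t D u c" and ?h = "mesh_size N"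
  have h: "?h > 0"
    using assms(5) by (auto intro: mesh_size_pos)
  have int: "r integrable_on cell N j" "r' integrable_on cell N j"
    using V_h_has_integral assms(2,3,5) by blast+
  have "inner_L2 (\<lambda>x. (r' x - r x) / \<Delta>t) ?\<zeta> = integral (cell N j) (\<lambda>x. (r' x - r x) / \<Delta>t)"
    using assms(5) by (rule inner_L2_cell_indicator)
  also have "\<dots> = (integral (cell N j) r' - integral (cell N j) r) / \<Delta>t"
    using int by (simp add: integral_diff)
  also have "\<dots> = ?h * (cell_average N r' j - cell_average N r j) / \<Delta>t"
    using h by (simp add: cell_average_def flip: right_diff_distrib diff_divide_distrib)
  finally have lhs: "inner_L2 (\<lambda>x. (r' x - r x) / \<Delta>t) ?\<zeta>
      = ?h * (cell_average N r' j - cell_average N r j) / \<Delta>t" .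
  \<comment> \<open>The symmetrising interface term vanishes because the test function has slope zero.\<close>
  have avg0: "(\<Sum>k = 1..N - 1. average_diffusion N D u ?\<zeta> k * jump N c k) = 0"
    using assms(5) by (intro sum.neutral) (simp add: average_diffusion_cell_indicator)
  have "?h * (cell_average N r' j - cell_average N r j) / \<Delta>t
      = (\<Sum>k = 1..N - 1. ?G k * jump N ?\<zeta> k) + inner_gauss N S ?\<zeta>"
    using assms(1)[unfolded transport_equation_def, rule_format, OF cell_indicator_in_V_h[OF assms(5)]]
    unfolding lhs inner_L2_deriv_cell_indicator[OF assms(5)] avg0 S_def
    by (simp add: interface_flux_def sum_subtractf left_diff_distrib)
  also have "\<dots> = of_bool (2 \<le> j) * ?G (j - 1) - of_bool (j < N) * ?G j
      + ?h / 2 * (S (gauss_point N 1 j) + S (gauss_point N 2 j))"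
    using assms(5) by (simp add: sum_jump_cell_indicator inner_gauss_cell_indicator)
  finally show ?thesis
    using h assms(4) by (simp add: field_simps)
qed

section \<open>One-sided bounds for the flux through an interface\<close>

lemma interface_flux_traces:
  assumes "c \<in> V_h N" "j \<in> {1..N - 1}"
  shows "interface_flux N \<alpha> \<alpha>t D u c j =
    \<alpha> * trace_minus N c j - (\<alpha> - trace_plus N u j) * trace_plus N c j
    - (D (trace_plus N u j) / 2 * (trace_minus N c (j + 1) - trace_plus N c j)
       + D (trace_minus N u j) / 2 * (trace_minus N c j - trace_plus N c (j - 1))
       + \<alpha>t * (trace_plus N c j - trace_minus N c j)) / mesh_size N"
proof -
  have "mesh_size N > 0" "j \<noteq> 0" "j \<noteq> N" and j1: "j + 1 \<in> {1..N}"
    using assms(2) by (auto intro: mesh_size_pos)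
  moreover have "trace_plus N (deriv c) j = cell_slope N c (j + 1)"
    using trace_plus_deriv[OF assms(1) j1] by simp
  moreover have "trace_minus N (deriv c) j = cell_slope N c j"
    using assms by (intro trace_minus_deriv) auto
  ultimately show ?thesis
    by (simp add: interface_flux_def flux_uc_def average_diffusion_def jump_def)
      (simp add: cell_slope_def field_simps)
qed

text \<open>The outflow through the right end of cell \<open>j\<close>, bounded by the end values of that cell alone. The
  values of \<open>c\<close> in cell \<open>j + 1\<close> enter with the coefficients \<open>-(\<alpha> - u\<^sup>+)\<close>, \<open>-(\<alpha>\<^sub>t - D\<^sup>+/2) / \<Delta>x\<close> and
  \<open>- D\<^sup>+ / (2 \<Delta>x)\<close>, all nonpositive under the hypotheses and the first strictly negative.\<close>

lemma interface_flux_less: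
  assumes "c \<in> V_h N" "j \<in> {1..N - 1}"
    and pos: "\<And>k. k \<in> {1..N} \<Longrightarrow> trace_plus N c (k - 1) > 0"
      "\<And>k. k \<in> {1..N} \<Longrightarrow> trace_minus N c k > 0"
    and "trace_plus N u j < \<alpha>" "0 \<le> D (trace_plus N u j)" "D (trace_plus N u j) \<le> 2 * \<alpha>t"
      "0 \<le> D (trace_minus N u j)"
  shows "interface_flux N \<alpha> \<alpha>t D u c j < \<alpha> * trace_minus N c j
    + (\<alpha>t * trace_minus N c j + D (trace_minus N u j) / 2 * trace_plus N c (j - 1)) / mesh_size N"
proof -
  have h: "mesh_size N > 0"
    using assms(2) by (auto intro: mesh_size_pos)
  have c: "trace_minus N c (j + 1) > 0" "trace_plus N c j > 0" "trace_minus N c j > 0"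
    using pos(2)[of "j + 1"] pos(1)[of "j + 1"] pos(2)[of j] assms(2) by auto
  have "(\<alpha> - trace_plus N u j) * trace_plus N c j > 0"
    using c assms(5) by simp
  moreover have "0 \<le> D (trace_plus N u j) / 2 * trace_minus N c (j + 1)
      + (\<alpha>t - D (trace_plus N u j) / 2) * trace_plus N c j
      + D (trace_minus N u j) / 2 * trace_minus N c j"
    using c assms(6-8) by (intro add_nonneg_nonneg mult_nonneg_nonneg) auto
  then have "- ((D (trace_plus N u j) / 2 * (trace_minus N c (j + 1) - trace_plus N c j)
       + D (trace_minus N u j) / 2 * (trace_minus N c j - trace_plus N c (j - 1))
       + \<alpha>t * (trace_plus N c j - trace_minus N c j)) / mesh_size N)
    \<le> (\<alpha>t * trace_minus N c j + D (trace_minus N u j) / 2 * trace_plus N c (j - 1)) / mesh_size N"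
    unfolding minus_divide_left
    using h by (intro divide_right_mono) (auto simp: algebra_simps)
  ultimately show ?thesis
    unfolding interface_flux_traces[OF assms(1,2)] by linarith
qed

text \<open>The mirror image, for the loss through the left end of cell \<open>j + 1\<close>. The upwind bias of the
  convective flux makes the two bounds differ: here the value that makes the inequality strict carries
  the coefficient \<open>-\<alpha>\<close>.\<close>

lemma interface_flux_greater:
  assumes "c \<in> V_h N" "j \<in> {1..N - 1}"
    and pos: "\<And>k. k \<in> {1..N} \<Longrightarrow> trace_plus N c (k - 1) > 0"
      "\<And>k. k \<in> {1..N} \<Longrightarrow> trace_minus N c k > 0"
    and "0 < \<alpha>" "0 \<le> D (trace_minus N u j)" "D (trace_minus N u j) \<le> 2 * \<alpha>t"
      "0 \<le> D (trace_plus N u j)"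
  shows "- interface_flux N \<alpha> \<alpha>t D u c j < (\<alpha> - trace_plus N u j) * trace_plus N c j
    + (\<alpha>t * trace_plus N c j + D (trace_plus N u j) / 2 * trace_minus N c (j + 1)) / mesh_size N"
proof -
  have h: "mesh_size N > 0"
    using assms(2) by (auto intro: mesh_size_pos)
  have c: "trace_plus N c (j - 1) > 0" "trace_plus N c j > 0" "trace_minus N c j > 0"
    using pos(1)[of j] pos(1)[of "j + 1"] pos(2)[of j] assms(2) by auto
  have "\<alpha> * trace_minus N c j > 0"
    using c assms(5) by simp
  moreover have "0 \<le> D (trace_minus N u j) / 2 * trace_plus N c (j - 1)
      + (\<alpha>t - D (trace_minus N u j) / 2) * trace_minus N c j
      + D (trace_plus N u j) / 2 * trace_plus N c j"
    using c assms(6-8) by (intro add_nonneg_nonneg mult_nonneg_nonneg) auto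
  then have "(D (trace_plus N u j) / 2 * (trace_minus N c (j + 1) - trace_plus N c j)
       + D (trace_minus N u j) / 2 * (trace_minus N c j - trace_plus N c (j - 1))
       + \<alpha>t * (trace_plus N c j - trace_minus N c j)) / mesh_size N
    \<le> (\<alpha>t * trace_plus N c j + D (trace_plus N u j) / 2 * trace_minus N c (j + 1)) / mesh_size N"
    using h by (intro divide_right_mono) (auto simp: algebra_simps)
  ultimately show ?thesis
    unfolding interface_flux_traces[OF assms(1,2)] by simp
qed

section \<open>Time step bounds and the source term\<close>

lemma le_bound_fracD:
  assumes "ereal x \<le> bound_frac a b" "0 \<le> a" "0 \<le> b"
  shows "x * b \<le> a"
  using assms by (auto simp: bound_frac_def field_simps split: if_splits)

lemma le_Min_imageD:
  fixes f :: "'i \<Rightarrow> 'b :: linorder"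
  assumes "a \<le> Min (f ` A)" "finite A" "k \<in> A"
  shows "a \<le> f k"
  using assms by (meson Min_le finite_imageI imageI order_trans)

text \<open>At points with \<open>q < 0\<close> the external concentration is \<open>c\<close> itself, so the loss is proportional to
  what is present and a small time step controls it; elsewhere the term only adds. The bound \<open>P\<close> stands for \<open>p\<^sub>M\<close>,
  and \<open>w\<close> for the smaller of the two porosities at the ends of the cell.\<close>

lemma source_pointwise:
  fixes w :: real
  assumes "ext \<ge> 0" "q < 0 \<Longrightarrow> ext = c" "c > 0" "rv > 0"
    and "\<Delta>t > 0" "z1 > 0" "pt \<le> P" "\<Delta>t * (6 * z1 * P) \<le> 1"
    and "\<Delta>t * (6 * max (- q) 0) \<le> w"
  shows "\<Delta>t * (ext * q - rv * z1 * pt) \<ge> - (w * c + rv) / 6"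
proof -
  have "\<Delta>t * (rv * z1 * pt) \<le> \<Delta>t * (rv * z1 * P)"
    using assms by (intro mult_left_mono) auto
  also have "\<dots> = rv / 6 * (\<Delta>t * (6 * z1 * P))"
    by simp
  also have "\<dots> \<le> rv / 6 * 1"
    using assms by (intro mult_left_mono) auto
  finally have "\<Delta>t * (rv * z1 * pt) \<le> rv / 6" by simp
  moreover have "\<Delta>t * (ext * q) \<ge> - (w * c) / 6"
  proof (cases "q < 0")
    case True
    then have "c * (\<Delta>t * (6 * (- q))) \<le> c * w"
      using assms(3,9) by (intro mult_left_mono) auto
    then show ?thesis
      using assms(2)[OF True] by (simp add: algebra_simps)
  next
    case False
    then have "\<Delta>t * (ext * q) \<ge> 0" "w \<ge> 0"
      using assms by auto
    then show ?thesis
      using assms(3) by (smt (verit) divide_nonneg_nonneg mult_nonneg_nonneg minus_divide_left)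
  qed
  ultimately show ?thesis
    by (simp add: right_diff_distrib add_divide_distrib diff_divide_distrib)
qed

lemma pt_le_p_M:
  assumes "i \<in> {1, 2}" "j \<in> {1..N}"
  shows "max (pt (gauss_point N i j)) 0 \<le> p_M N pt"
  unfolding p_M_def
proof (rule Max_ge)
  have "(i, j) \<in> {1..2} \<times> {1..N}"
    using assms by auto
  then show "max (pt (gauss_point N i j)) 0
      \<in> (\<lambda>(i, j). max (pt (gauss_point N i j)) 0) ` ({1..2} \<times> {1..N})"
    by (rule rev_image_eqI) simp
qed simp

lemma p_M_nonneg: "N \<ge> 1 \<Longrightarrow> 0 \<le> p_M N pt"
  using pt_le_p_M[of 1 1 N pt] by simp

lemma source_lower_bound:
  assumes "r \<in> V_h N" "c \<in> V_h N" "j \<in> {1..N}"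
    and "trace_plus N r (j - 1) > 0" "trace_minus N r j > 0"
    and "trace_plus N c (j - 1) > 0" "trace_minus N c j > 0"
    and ext: "external_concentration N q c ct"
    and "\<Delta>t > 0" "z1 > 0" "\<Delta>t * (6 * z1 * p_M N pt) \<le> 1"
    and w: "\<And>i. i \<in> {1, 2} \<Longrightarrow> \<Delta>t * (6 * max (- q (gauss_point N i j)) 0) \<le> w"
  defines "S \<equiv> \<lambda>x. ct x * q x - r x * z1 * pt x"
  shows "\<Delta>t / 2 * (S (gauss_point N 1 j) + S (gauss_point N 2 j))
    \<ge> - (w * (trace_plus N c (j - 1) + trace_minus N c j)
        + (trace_plus N r (j - 1) + trace_minus N r j)) / 12"
proof -
  have source: "\<Delta>t * S (gauss_point N i j)
      \<ge> - (w * c (gauss_point N i j) + r (gauss_point N i j)) / 6" if i: "i \<in> {1, 2}" for i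
    unfolding S_def
  proof (rule source_pointwise[where P = "p_M N pt"])
    have x: "gauss_point N i j \<in> cell N j"
      using assms(3) by (rule gauss_point_in_cell)
    show c: "c (gauss_point N i j) > 0"
      using assms(2,3) x assms(6,7) by (rule V_h_pos_in_cell)
    show "r (gauss_point N i j) > 0"
      using assms(1,3) x assms(4,5) by (rule V_h_pos_in_cell)
    show "ct (gauss_point N i j) \<ge> 0"
      "q (gauss_point N i j) < 0 \<Longrightarrow> ct (gauss_point N i j) = c (gauss_point N i j)"
      using ext[unfolded external_concentration_def, rule_format, OF assms(3) x] c
      by (auto split: if_splits)
    show "pt (gauss_point N i j) \<le> p_M N pt"
      using pt_le_p_M[OF i assms(3), of pt] by simp
  qed (use assms(9-11) w[OF i] in auto)
  have "- (w * (c (gauss_point N 1 j) + c (gauss_point N 2 j))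
           + (r (gauss_point N 1 j) + r (gauss_point N 2 j))) / 12
      \<le> \<Delta>t / 2 * (S (gauss_point N 1 j) + S (gauss_point N 2 j))"
    using source[of 1] source[of 2] by (simp add: field_simps)
  then show ?thesis
    unfolding V_h_gauss_sum[OF assms(1,3)] V_h_gauss_sum[OF assms(2,3)] .
qed

theorem theorem3p1:
  fixes N :: nat
    and \<phi> \<Phi> \<mu> \<kappa> q ct D :: "real \<Rightarrow> real"
    and z1 z2 \<alpha> \<alpha>t \<Delta>t :: real
    and p u r c pt r_next :: "real \<Rightarrow> real"
  assumes "N \<ge> 2"
    and "\<forall>x\<in>{0..2 * pi}. \<phi> x > 0" and "pl_interpolant N \<phi> \<Phi>"
    and "z1 > 0" and "z2 > 0"
    and "\<forall>v. D v \<ge> 0"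
    and "\<alpha> > 0" and "\<alpha>t > 0" and "\<Delta>t > 0"
    and "p \<in> V_h N" and "u \<in> V_h N" and "r \<in> V_h N" and "pt \<in> V_h N" and "r_next \<in> V_h N"
    and "concentration_of N \<Phi> r c"
    and "external_concentration N q c ct"
    and "pressure_equation N z1 z2 \<Phi> q pt u r"
    and "velocity_equation N \<mu> \<kappa> p u c"
    and "transport_equation N z1 \<alpha> \<alpha>t D q ct pt u r c (\<lambda>x. (r_next x - r x) / \<Delta>t)"
    and "positive_on_cells N r"
    and "\<alpha> > Max ((\<lambda>j. max (trace_plus N u j) 0) ` {1..N - 1})"
    and "\<alpha>t > 1 / 2 * D_M N D u"
    and "ereal \<Delta>t \<le> bound_frac 1 (6 * z1 * p_M N pt)"
    and "ereal \<Delta>t \<le> Min ((\<lambda>j. bound_frac (min (\<Phi> (node N (j - 1))) (\<Phi> (node N j)))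
            (6 * max (max (- q (gauss_point N 1 j)) (- q (gauss_point N 2 j))) 0)) ` {1..N})"
    and "ereal (\<Delta>t / mesh_size N) \<le> Min ((\<lambda>j. min (bound_frac (Phi_m N \<Phi>) (6 * \<alpha>))
            (bound_frac (\<Phi> (node N j)) (6 * (\<alpha> - trace_plus N u j)))) ` {1..N - 1})"
    and "ereal (\<Delta>t / (mesh_size N)\<^sup>2) \<le> Min ((\<lambda>j. min
            (bound_frac (\<Phi> (node N (j - 1))) (6 * \<alpha>t + 3 * D (trace_minus N u j)))
            (bound_frac (\<Phi> (node N j)) (6 * \<alpha>t + 3 * D (trace_plus N u (j - 1))))) ` {1..N})"
  shows "\<forall>j\<in>{1..N}. cell_average N r_next j > 0"
proof
  fix j assume j: "j \<in> {1..N}"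
  note N = assms(1) and \<phi>_pos = assms(2) and \<Phi> = assms(3) and z1 = assms(4) and D = assms(6)
    and \<alpha> = assms(7) and \<alpha>t = assms(8) and \<Delta>t = assms(9) and V = assms(10-14)
    and conc = assms(15) and ext = assms(16) and transport = assms(19) and r_pos = assms(20)
    and \<alpha>_gt = assms(21) and \<alpha>t_gt = assms(22)
  define h where "h = mesh_size N"
  define G where "G = interface_flux N \<alpha> \<alpha>t D u c"
  define S where "S = (\<lambda>x. ct x * q x - r x * z1 * pt x)"
  \<comment> \<open>The end values of \<open>c\<close> seen from inside the cell, and the porosity there.\<close>
  define cp cm Fl Fr where "cp = trace_plus N c (j - 1)" and "cm = trace_minus N c j"
    and "Fl = \<Phi> (node N (j - 1))" and "Fr = \<Phi> (node N j)"
  \<comment> \<open>\<open>B / 2\<close> is the old average; source, convection and diffusion may each use \<open>B / 6\<close>.\<close>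
  define B where "B = Fl * cp + Fr * cm"
  define T where "T = \<Delta>t / 2 * (S (gauss_point N 1 j) + S (gauss_point N 2 j))"
  define w where "w = min Fl Fr"
  note abbrs = cp_def cm_def Fl_def Fr_def
  have h: "h > 0"
    using N by (simp add: h_def mesh_size_pos)
  have c_V: "c \<in> V_h N"
    using conc by (simp add: concentration_of_def)

  have \<Phi>_pos: "\<Phi> (node N k) > 0" if "k \<le> N" for k
    using \<Phi> \<phi>_pos node_in_domain[of N k] that N by (simp add: pl_interpolant_def)
  have F: "Fl > 0" "Fr > 0"
    using \<Phi>_pos[of "j - 1"] \<Phi>_pos[of j] j by (auto simp: abbrs)
  have c_pos: "trace_plus N c (k - 1) > 0" "trace_minus N c k > 0" if "k \<in> {1..N}" for k
    using conc r_pos that \<Phi>_pos[of k] \<Phi>_pos[of "k - 1"]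
    by (auto simp: concentration_of_def positive_on_cells_def)
  have cpm: "cp > 0" "cm > 0"
    using c_pos[OF j] by (simp_all add: abbrs)
  have r_traces: "trace_plus N r (j - 1) = Fl * cp" "trace_minus N r j = Fr * cm"
    using conc j F by (auto simp: concentration_of_def abbrs)

  have u_less: "trace_plus N u k < \<alpha>" if "k \<in> {1..N - 1}" for k
  proof -
    have "trace_plus N u k \<le> max (trace_plus N u k) 0"
      by simp
    also have "\<dots> \<le> Max ((\<lambda>j. max (trace_plus N u j) 0) ` {1..N - 1})"
      using that by (intro Max_ge) auto
    also have "\<dots> < \<alpha>"
      by (rule \<alpha>_gt)
    finally show ?thesis .
  qed
  have D_le: "D (trace_plus N u k) \<le> 2 * \<alpha>t" "D (trace_minus N u k) \<le> 2 * \<alpha>t"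
    if "k \<in> {1..N - 1}" for k
  proof -
    have "max (D (trace_plus N u k)) (D (trace_minus N u k)) \<le> D_M N D u"
      unfolding D_M_def using that by (intro Max_ge) auto
    then show "D (trace_plus N u k) \<le> 2 * \<alpha>t" "D (trace_minus N u k) \<le> 2 * \<alpha>t"
      using \<alpha>t_gt by auto
  qed

  have p_M: "0 \<le> p_M N pt"
    using N by (intro p_M_nonneg) auto
  have dt_p: "\<Delta>t * (6 * z1 * p_M N pt) \<le> 1"
    using assms(23) z1 p_M by (intro le_bound_fracD) auto
  have "\<Delta>t * (6 * max (max (- q (gauss_point N 1 j)) (- q (gauss_point N 2 j))) 0)
      \<le> min Fl Fr"
  proof (rule le_bound_fracD)
    show "ereal \<Delta>t \<le> bound_frac (min Fl Fr)
        (6 * max (max (- q (gauss_point N 1 j)) (- q (gauss_point N 2 j))) 0)"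
      unfolding abbrs by (rule le_Min_imageD[OF assms(24) finite_atLeastAtMost j])
  qed (use F in auto)
  then have dt_q: "\<Delta>t * (6 * max (max (- q (gauss_point N 1 j)) (- q (gauss_point N 2 j))) 0)
      \<le> w"
    by (simp only: w_def)

  \<comment> \<open>The source uses at most \<open>B / 6\<close>: half of it pays for the pressure term, half for production.\<close>
  have "T \<ge> - (w * (cp + cm) + B) / 12"
    unfolding T_def S_def cp_def cm_def B_def r_traces(1)[unfolded cp_def, symmetric]
      r_traces(2)[unfolded cm_def, symmetric]
  proof (rule source_lower_bound)
    show "\<Delta>t * (6 * max (- q (gauss_point N i j)) 0) \<le> w" if i: "i \<in> {1, 2}" for i
    proof -
      have "max (- q (gauss_point N i j)) 0
          \<le> max (max (- q (gauss_point N 1 j)) (- q (gauss_point N 2 j))) 0"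
        using i by auto
      then have "\<Delta>t * (6 * max (- q (gauss_point N i j)) 0)
          \<le> \<Delta>t * (6 * max (max (- q (gauss_point N 1 j)) (- q (gauss_point N 2 j))) 0)"
        using \<Delta>t by (intro mult_left_mono) auto
      then show ?thesis
        using dt_q by (rule order_trans)
    qed
  qed (use V c_V j r_pos c_pos[OF j] ext \<Delta>t z1 dt_p in \<open>auto simp: positive_on_cells_def\<close>)
  moreover have "w * (cp + cm) \<le> B"
    unfolding distrib_left B_def w_def using cpm by (intro add_mono mult_right_mono) auto
  then have "- (B + B) / 12 \<le> - (w * (cp + cm) + B) / 12"
    by (intro divide_right_mono) auto
  ultimately have "- (B + B) / 12 \<le> T"
    by (rule order_trans[rotated])
  then have source_bound: "- (B / 6) \<le> T"
    by simp

  \<comment> \<open>The time step conditions as bounds on the coefficients of \<open>cp\<close> and \<open>cm\<close> in the fluxes.\<close>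
  define lam Lam where "lam = \<Delta>t / h" and "Lam = \<Delta>t / h\<^sup>2"
  have lam: "lam > 0" "Lam = lam / h" "Lam > 0"
    using h \<Delta>t by (simp_all add: lam_def Lam_def power2_eq_square)
  have lam_le: "lam * \<alpha> \<le> \<Phi> (node N k) / 6"
    "lam * (\<alpha> - trace_plus N u k) \<le> \<Phi> (node N k) / 6" if k: "k \<in> {1..N - 1}" for k
  proof -
    have le: "ereal lam \<le> bound_frac (Phi_m N \<Phi>) (6 * \<alpha>)"
      "ereal lam \<le> bound_frac (\<Phi> (node N k)) (6 * (\<alpha> - trace_plus N u k))"
      using le_Min_imageD[OF assms(25) finite_atLeastAtMost k] unfolding h_def lam_def by simp_all
    have \<Phi>k: "0 \<le> \<Phi> (node N k)"
      using k by (intro less_imp_le \<Phi>_pos) auto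
    have m: "Phi_m N \<Phi> \<le> \<Phi> (node N k)"
      unfolding Phi_m_def using k by (intro Min_le) auto
    have "Phi_m N \<Phi> \<in> (\<lambda>j. \<Phi> (node N j)) ` {1..N - 1}"
      unfolding Phi_m_def using k by (intro Min_in) auto
    then have "0 \<le> Phi_m N \<Phi>"
      using \<Phi>_pos by (auto intro!: less_imp_le)
    then show "lam * \<alpha> \<le> \<Phi> (node N k) / 6"
      using le_bound_fracD[OF le(1)] m \<alpha> by simp
    show "lam * (\<alpha> - trace_plus N u k) \<le> \<Phi> (node N k) / 6"
      using le_bound_fracD[OF le(2)] \<Phi>k u_less[OF k]
      by (simp add: algebra_simps)
  qed
  define Dm Dp where "Dm = D (trace_minus N u j)" and "Dp = D (trace_plus N u (j - 1))"
  have D_nonneg: "Dm \<ge> 0" "Dp \<ge> 0"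
    using D by (auto simp: Dm_def Dp_def)
  have Lam_frac: "ereal Lam \<le> bound_frac Fl (6 * \<alpha>t + 3 * Dm)"
    "ereal Lam \<le> bound_frac Fr (6 * \<alpha>t + 3 * Dp)"
    using le_Min_imageD[OF assms(26) finite_atLeastAtMost j]
    unfolding h_def abbrs Lam_def Dm_def Dp_def by simp_all
  have Lam_le: "Lam * (\<alpha>t + Dm / 2) \<le> Fl / 6" "Lam * (\<alpha>t + Dp / 2) \<le> Fr / 6"
    using le_bound_fracD[OF Lam_frac(1)] le_bound_fracD[OF Lam_frac(2)] F \<alpha>t D_nonneg
    by (simp_all add: algebra_simps)

  have outflow: "lam * G j < Fr * cm / 6 + Lam * (\<alpha>t * cm + Dm / 2 * cp)" if "j < N"
  proof -
    have k: "j \<in> {1..N - 1}"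
      using that j by auto
    have "G j < \<alpha> * cm + (\<alpha>t * cm + Dm / 2 * cp) / h"
      unfolding G_def cm_def cp_def Dm_def h_def using c_V k c_pos u_less[OF k]
      by (rule interface_flux_less) (use D D_le[OF k] in auto)
    then have "lam * G j < lam * (\<alpha> * cm + (\<alpha>t * cm + Dm / 2 * cp) / h)"
      using lam(1) by (rule mult_strict_left_mono)
    also have "\<dots> = lam * \<alpha> * cm + Lam * (\<alpha>t * cm + Dm / 2 * cp)"
      using h by (simp add: lam(2) field_simps)
    also have "lam * \<alpha> * cm \<le> Fr / 6 * cm"
      using lam_le(1)[OF k] cpm by (intro mult_right_mono) (auto simp: abbrs)
    finally show ?thesis
      by simp
  qed
  have inflow: "- (lam * G (j - 1))
      < Fl * cp / 6 + Lam * (\<alpha>t * cp + Dp / 2 * cm)" if "2 \<le> j"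
  proof -
    have k: "j - 1 \<in> {1..N - 1}" and j1: "j - 1 + 1 = j"
      using that j by auto
    have "- G (j - 1) < (\<alpha> - trace_plus N u (j - 1)) * cp + (\<alpha>t * cp + Dp / 2 * cm) / h"
      using interface_flux_greater[of c N "j - 1" \<alpha> D u \<alpha>t, OF c_V k c_pos \<alpha>] D D_le(2)[OF k]
      unfolding G_def cm_def cp_def Dp_def h_def j1 by blast
    then have "lam * (- G (j - 1))
        < lam * ((\<alpha> - trace_plus N u (j - 1)) * cp + (\<alpha>t * cp + Dp / 2 * cm) / h)"
      using lam(1) by (rule mult_strict_left_mono)
    also have "\<dots> = lam * (\<alpha> - trace_plus N u (j - 1)) * cp
        + Lam * (\<alpha>t * cp + Dp / 2 * cm)"
      using h by (simp add: lam(2) field_simps)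
    also have "lam * (\<alpha> - trace_plus N u (j - 1)) * cp \<le> Fl / 6 * cp"
      using lam_le(2)[OF k] cpm by (intro mult_right_mono) (auto simp: abbrs)
    finally show ?thesis
      by simp
  qed
  \<comment> \<open>On the boundary of the domain the flux is absent, and the bound for it is nonnegative.\<close>
  have nonneg: "0 \<le> Fr * cm / 6 + Lam * (\<alpha>t * cm + Dm / 2 * cp)"
    "0 \<le> Fl * cp / 6 + Lam * (\<alpha>t * cp + Dp / 2 * cm)"
    using F cpm lam(3) \<alpha>t D_nonneg by simp_all
  \<comment> \<open>With at least two cells one end is an interior interface, where the flux bound is strict.\<close>
  have "j < N \<or> 2 \<le> j"
    using N j by auto
  then have "of_bool (j < N) * (lam * G j) - of_bool (2 \<le> j) * (lam * G (j - 1))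
      < (Fr * cm / 6 + Lam * (\<alpha>t * cm + Dm / 2 * cp))
        + (Fl * cp / 6 + Lam * (\<alpha>t * cp + Dp / 2 * cm))"
    using outflow inflow nonneg by (cases "j < N"; cases "2 \<le> j") simp_all
  also have "\<dots> = B / 6 + Lam * (\<alpha>t + Dm / 2) * cp
      + Lam * (\<alpha>t + Dp / 2) * cm"
    by (simp add: B_def algebra_simps add_divide_distrib)
  also have "\<dots> \<le> B / 6 + Fl / 6 * cp + Fr / 6 * cm"
    using Lam_le cpm by (intro add_mono mult_right_mono) auto
  also have "\<dots> = B / 3"
    by (simp add: B_def field_simps)
  finally have flux_bound: "of_bool (j < N) * (lam * G j)
      - of_bool (2 \<le> j) * (lam * G (j - 1)) < B / 3" .

  have "cell_average N r_next j = B / 2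
      - (of_bool (j < N) * (lam * G j) - of_bool (2 \<le> j) * (lam * G (j - 1)))
      + T"
    using cell_average_update[OF transport V(3,5) \<Delta>t j] cell_average_V_h[OF V(3) j]
    unfolding r_traces G_def[symmetric] B_def T_def S_def h_def[symmetric] lam_def[symmetric]
    by (simp add: right_diff_distrib)
  then show "cell_average N r_next j > 0"
    using flux_bound source_bound by linarith
qed

end
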